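(* Every $\mathrm{B}$-category $\mathcal{B}$ is balanced: a morphism of $\mathcal{B}$ that is both a monomorphism and an epimorphism is an isomorphism.
   Context: In a category with finite co-products, write $\mathbf{0}$ for the initial object; an object is empty if it is isomorphic to $\mathbf{0}$. An object $X$ is an atom (atomic) if it is non-empty and, whenever $X \cong Y \amalg Z$, either $Y$ or $Z$ is empty. A $\mathrm{B}$-category is an essentially small category $\mathcal{B}$ such that: (a) $\mathcal{B}$ has finite co-products; (b) every object is isomorphic to a finite co-product of atoms; (c) for objects $X,Y,Z$ with $X$ atomic, the natural map $\mathrm{Hom}(X,Y)\amalg \mathrm{Hom}(X,Z)\to \mathrm{Hom}(X,Y\amalg Z)$ is a bijection; (d) $\mathcal{B}$ has fiber products and a final object $\mathbf{1}$; (e) any monomorphism of atoms is an isomorphism. *)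

theory Defs
  imports Main
begin

(* Objects and morphisms are carrier sets in arbitrary HOL types, so every category below
   is small, and essential smallness imposes no condition. *)

record ('o, 'm) cat_data =
  obj :: "'o set"
  mor :: "'m set"
  src :: "'m \<Rightarrow> 'o"
  tgt :: "'m \<Rightarrow> 'o"
  ident :: "'o \<Rightarrow> 'm"
  compose :: "'m \<Rightarrow> 'm \<Rightarrow> 'm"  (infixl "\<cdot>\<index>" 70)

definition Hom :: "('o, 'm, 'e) cat_data_scheme \<Rightarrow> 'o \<Rightarrow> 'o \<Rightarrow> 'm set" where
  "Hom C X Y = {f \<in> mor C. src C f = X \<and> tgt C f = Y}"

locale category =
  fixes C :: "('o, 'm, 'e) cat_data_scheme" (structure)
  assumes src_in_obj: "f \<in> mor C \<Longrightarrow> src C f \<in> obj C"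
    and tgt_in_obj: "f \<in> mor C \<Longrightarrow> tgt C f \<in> obj C"
    and ident_in_Hom: "X \<in> obj C \<Longrightarrow> ident C X \<in> Hom C X X"
    and compose_in_Hom: "\<lbrakk>f \<in> Hom C X Y; g \<in> Hom C Y Z\<rbrakk> \<Longrightarrow> g \<cdot> f \<in> Hom C X Z"
    and compose_ident: "f \<in> Hom C X Y \<Longrightarrow> f \<cdot> ident C X = f"
    and ident_compose: "f \<in> Hom C X Y \<Longrightarrow> ident C Y \<cdot> f = f"
    and compose_assoc:
      "\<lbrakk>f \<in> Hom C W X; g \<in> Hom C X Y; h \<in> Hom C Y Z\<rbrakk> \<Longrightarrow> (h \<cdot> g) \<cdot> f = h \<cdot> (g \<cdot> f)"

definition is_mono :: "('o, 'm, 'e) cat_data_scheme \<Rightarrow> 'm \<Rightarrow> bool" where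
  "is_mono C f \<longleftrightarrow> f \<in> mor C \<and>
     (\<forall>T\<in>obj C. \<forall>g\<in>Hom C T (src C f). \<forall>h\<in>Hom C T (src C f).
        f \<cdot>\<^bsub>C\<^esub> g = f \<cdot>\<^bsub>C\<^esub> h \<longrightarrow> g = h)"

definition is_epi :: "('o, 'm, 'e) cat_data_scheme \<Rightarrow> 'm \<Rightarrow> bool" where
  "is_epi C f \<longleftrightarrow> f \<in> mor C \<and>
     (\<forall>T\<in>obj C. \<forall>g\<in>Hom C (tgt C f) T. \<forall>h\<in>Hom C (tgt C f) T.
        g \<cdot>\<^bsub>C\<^esub> f = h \<cdot>\<^bsub>C\<^esub> f \<longrightarrow> g = h)"

definition is_iso :: "('o, 'm, 'e) cat_data_scheme \<Rightarrow> 'm \<Rightarrow> bool" where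
  "is_iso C f \<longleftrightarrow> f \<in> mor C \<and>
     (\<exists>g\<in>Hom C (tgt C f) (src C f).
        g \<cdot>\<^bsub>C\<^esub> f = ident C (src C f) \<and> f \<cdot>\<^bsub>C\<^esub> g = ident C (tgt C f))"

definition isomorphic :: "('o, 'm, 'e) cat_data_scheme \<Rightarrow> 'o \<Rightarrow> 'o \<Rightarrow> bool" where
  "isomorphic C X Y \<longleftrightarrow> X \<in> obj C \<and> Y \<in> obj C \<and> (\<exists>f\<in>Hom C X Y. is_iso C f)"

definition is_initial :: "('o, 'm, 'e) cat_data_scheme \<Rightarrow> 'o \<Rightarrow> bool" where
  "is_initial C I \<longleftrightarrow> I \<in> obj C \<and> (\<forall>X\<in>obj C. \<exists>!f. f \<in> Hom C I X)"

definition is_final :: "('o, 'm, 'e) cat_data_scheme \<Rightarrow> 'o \<Rightarrow> bool" where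
  "is_final C F \<longleftrightarrow> F \<in> obj C \<and> (\<forall>X\<in>obj C. \<exists>!f. f \<in> Hom C X F)"

(* P with the list js of structure maps is a co-product of the finite family Xs.
   The case Xs = [] says that P is initial; Xs = [Y, Z] gives binary co-products. *)
definition is_coproduct ::
    "('o, 'm, 'e) cat_data_scheme \<Rightarrow> 'o list \<Rightarrow> 'o \<Rightarrow> 'm list \<Rightarrow> bool" where
  "is_coproduct C Xs P js \<longleftrightarrow>
     set Xs \<subseteq> obj C \<and> P \<in> obj C \<and>
     length js = length Xs \<and> (\<forall>k<length Xs. js ! k \<in> Hom C (Xs ! k) P) \<and>
     (\<forall>T\<in>obj C. \<forall>fs. length fs = length Xs \<and> (\<forall>k<length Xs. fs ! k \<in> Hom C (Xs ! k) T) \<longrightarrow>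
        (\<exists>!h. h \<in> Hom C P T \<and> (\<forall>k<length Xs. h \<cdot>\<^bsub>C\<^esub> (js ! k) = fs ! k)))"

definition has_finite_coproducts :: "('o, 'm, 'e) cat_data_scheme \<Rightarrow> bool" where
  "has_finite_coproducts C \<longleftrightarrow>
     (\<forall>Xs. set Xs \<subseteq> obj C \<longrightarrow> (\<exists>P js. is_coproduct C Xs P js))"

definition is_fiber_product ::
    "('o, 'm, 'e) cat_data_scheme \<Rightarrow> 'm \<Rightarrow> 'm \<Rightarrow> 'o \<Rightarrow> 'm \<Rightarrow> 'm \<Rightarrow> bool" where
  "is_fiber_product C f g P p q \<longleftrightarrow>
     f \<in> mor C \<and> g \<in> mor C \<and> tgt C f = tgt C g \<and> P \<in> obj C \<and>
     p \<in> Hom C P (src C f) \<and> q \<in> Hom C P (src C g) \<and> f \<cdot>\<^bsub>C\<^esub> p = g \<cdot>\<^bsub>C\<^esub> q \<and>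
     (\<forall>T\<in>obj C. \<forall>a\<in>Hom C T (src C f). \<forall>b\<in>Hom C T (src C g).
        f \<cdot>\<^bsub>C\<^esub> a = g \<cdot>\<^bsub>C\<^esub> b \<longrightarrow>
        (\<exists>!h. h \<in> Hom C T P \<and> p \<cdot>\<^bsub>C\<^esub> h = a \<and> q \<cdot>\<^bsub>C\<^esub> h = b))"

definition has_fiber_products :: "('o, 'm, 'e) cat_data_scheme \<Rightarrow> bool" where
  "has_fiber_products C \<longleftrightarrow>
     (\<forall>f\<in>mor C. \<forall>g\<in>mor C. tgt C f = tgt C g \<longrightarrow> (\<exists>P p q. is_fiber_product C f g P p q))"

definition is_empty_obj :: "('o, 'm, 'e) cat_data_scheme \<Rightarrow> 'o \<Rightarrow> bool" where
  "is_empty_obj C X \<longleftrightarrow> (\<exists>I. is_initial C I \<and> isomorphic C X I)"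

definition is_atom :: "('o, 'm, 'e) cat_data_scheme \<Rightarrow> 'o \<Rightarrow> bool" where
  "is_atom C X \<longleftrightarrow> X \<in> obj C \<and> \<not> is_empty_obj C X \<and>
     (\<forall>Y Z P i j. is_coproduct C [Y, Z] P [i, j] \<and> isomorphic C X P \<longrightarrow>
        is_empty_obj C Y \<or> is_empty_obj C Z)"

locale B_category = category C
  for C :: "('o, 'm, 'e) cat_data_scheme" (structure) +
  assumes finite_coproducts: "has_finite_coproducts C"
    and atomic_decomposition:
      "X \<in> obj C \<Longrightarrow>
        \<exists>As P js. (\<forall>A\<in>set As. is_atom C A) \<and> is_coproduct C As P js \<and> isomorphic C X P"
    and Hom_from_atom:
      "\<lbrakk>is_atom C X; is_coproduct C [Y, Z] P [i, j]\<rbrakk> \<Longrightarrow>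
        bij_betw (case_sum (\<lambda>f. i \<cdot> f) (\<lambda>g. j \<cdot> g)) (Hom C X Y <+> Hom C X Z) (Hom C X P)"
    and fiber_products: "has_fiber_products C"
    and final_object: "\<exists>F. is_final C F"
    and mono_of_atoms_iso:
      "\<lbrakk>is_atom C X; is_atom C Y; f \<in> Hom C X Y; is_mono C f\<rbrakk> \<Longrightarrow> is_iso C f"

definition balanced :: "('o, 'm, 'e) cat_data_scheme \<Rightarrow> bool" where
  "balanced C \<longleftrightarrow> (\<forall>f\<in>mor C. is_mono C f \<and> is_epi C f \<longrightarrow> is_iso C f)"

end

theory Submission imports Defs begin

text \<open>
  Let \<open>f : X \<rightarrow> Y\<close> be mono and epi. It suffices to lift each structure map \<open>b\<close> of a decomposition of
  \<open>Y\<close> into atoms along \<open>f\<close>: the lifts assemble to a section of \<open>f\<close>, and a mono with a section is an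
  isomorphism. Suppose \<open>b\<close> does not lift. Let \<open>v : Y \<rightarrow> Y \<amalg> Y\<close> be the second inclusion on the summand
  \<open>b\<close> and the first inclusion \<open>u\<close> on all other summands. An atom \<open>A\<close> of \<open>X\<close> maps into a single
  summand of \<open>Y\<close>. This summand is not \<open>b\<close>: otherwise \<open>A\<close> would map to it by a mono of atoms, which is
  an isomorphism, and its inverse would lift \<open>b\<close>. Hence \<open>u\<close> and \<open>v\<close> agree after \<open>f\<close>, so
  \<open>u = v\<close>, contradicting the disjointness of the two inclusions.
\<close>

section \<open>Monomorphisms, epimorphisms and isomorphisms in a category\<close>

context category
begin

lemma HomD: "f \<in> Hom C X Y \<Longrightarrow> f \<in> mor C \<and> src C f = X \<and> tgt C f = Y \<and> X \<in> obj C \<and> Y \<in> obj C"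
  using src_in_obj tgt_in_obj by (auto simp: Hom_def)

lemma is_monoI:
  assumes "f \<in> Hom C X Y"
    and "\<And>T g h. \<lbrakk>T \<in> obj C; g \<in> Hom C T X; h \<in> Hom C T X; f \<cdot> g = f \<cdot> h\<rbrakk> \<Longrightarrow> g = h"
  shows "is_mono C f"
  using assms HomD[OF assms(1)] by (auto simp: is_mono_def)

lemma is_monoD:
  assumes "is_mono C f" "f \<in> Hom C X Y" "g \<in> Hom C T X" "h \<in> Hom C T X" "f \<cdot> g = f \<cdot> h"
  shows "g = h"
  using assms HomD[OF assms(2)] HomD[OF assms(3)] by (auto simp: is_mono_def)

lemma is_epiD:
  assumes "is_epi C f" "f \<in> Hom C X Y" "g \<in> Hom C Y T" "h \<in> Hom C Y T" "g \<cdot> f = h \<cdot> f"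
  shows "g = h"
  using assms HomD[OF assms(2)] HomD[OF assms(3)] by (auto simp: is_epi_def)

lemma is_isoE:
  assumes "is_iso C f" "f \<in> Hom C X Y"
  obtains g where "g \<in> Hom C Y X" "g \<cdot> f = ident C X" "f \<cdot> g = ident C Y"
  using assms HomD[OF assms(2)] by (auto simp: is_iso_def)

lemma mono_compose:
  assumes f: "f \<in> Hom C X Y" "is_mono C f" and g: "g \<in> Hom C Y Z" "is_mono C g"
  shows "is_mono C (g \<cdot> f)"
proof (rule is_monoI)
  show "g \<cdot> f \<in> Hom C X Z" using f g by (blast intro: compose_in_Hom)
  fix T a b assume ab: "a \<in> Hom C T X" "b \<in> Hom C T X" and eq: "(g \<cdot> f) \<cdot> a = (g \<cdot> f) \<cdot> b"
  have "g \<cdot> (f \<cdot> a) = g \<cdot> (f \<cdot> b)" using eq ab f(1) g(1) by (simp add: compose_assoc)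
  then have "f \<cdot> a = f \<cdot> b" using is_monoD g ab f(1) by (blast intro: compose_in_Hom)
  then show "a = b" using is_monoD f ab by blast
qed

lemma mono_cancel:
  assumes f: "f \<in> Hom C X Y" and g: "g \<in> Hom C Y Z" and m: "is_mono C (g \<cdot> f)"
  shows "is_mono C f"
proof (rule is_monoI[OF f])
  fix T a b assume ab: "a \<in> Hom C T X" "b \<in> Hom C T X" and eq: "f \<cdot> a = f \<cdot> b"
  have "(g \<cdot> f) \<cdot> a = (g \<cdot> f) \<cdot> b" using eq ab f g by (simp add: compose_assoc)
  then show "a = b" using is_monoD[OF m compose_in_Hom[OF f g]] ab by blast
qed

lemma mono_with_section_iso:
  assumes f: "f \<in> Hom C X Y" "is_mono C f" and s: "s \<in> Hom C Y X" "f \<cdot> s = ident C Y"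
  shows "is_iso C f"
proof -
  \<comment> \<open>Both sides equal \<open>f\<close>; cancelling the mono \<open>f\<close> makes
    the section \<open>s\<close> a left inverse as well.\<close>
  have "f \<cdot> (s \<cdot> f) = f \<cdot> ident C X"
    using f s by (simp flip: compose_assoc add: ident_compose compose_ident)
  then have "s \<cdot> f = ident C X"
    using is_monoD f compose_in_Hom[OF f(1) s(1)] ident_in_Hom HomD[OF f(1)] by blast
  then show ?thesis using f s HomD[OF f(1)] by (auto simp: is_iso_def)
qed

section \<open>Finite co-products: universal property, transport and splitting off a summand\<close>

lemma coproduct_obj: "is_coproduct C Xs P js \<Longrightarrow> P \<in> obj C \<and> set Xs \<subseteq> obj C"
  and coproduct_length: "is_coproduct C Xs P js \<Longrightarrow> length js = length Xs"
  and coproduct_in: "is_coproduct C Xs P js \<Longrightarrow> k < length Xs \<Longrightarrow> js ! k \<in> Hom C (Xs ! k) P"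
  by (auto simp: is_coproduct_def)

lemma coproduct_ex1:
  assumes "is_coproduct C Xs P js" "T \<in> obj C" "length fs = length Xs"
    and "\<And>k. k < length Xs \<Longrightarrow> fs ! k \<in> Hom C (Xs ! k) T"
  shows "\<exists>!h. h \<in> Hom C P T \<and> (\<forall>k<length Xs. h \<cdot> (js ! k) = fs ! k)"
  using assms unfolding is_coproduct_def by blast

text \<open>The existence half of the universal property. The family is a function of the index
  rather than a list, so that it can be given by cases on the summand.\<close>

lemma coproduct_map:
  assumes "is_coproduct C Xs P js" "T \<in> obj C"
    and "\<And>k. k < length Xs \<Longrightarrow> F k \<in> Hom C (Xs ! k) T"
  obtains h where "h \<in> Hom C P T" "\<And>k. k < length Xs \<Longrightarrow> h \<cdot> (js ! k) = F k"
  using coproduct_ex1[OF assms(1,2), of "map F [0..<length Xs]"] assms(3) by auto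

lemma coproduct_eq:
  assumes c: "is_coproduct C Xs P js" and g: "g \<in> Hom C P T" and h: "h \<in> Hom C P T"
    and eq: "\<And>k. k < length Xs \<Longrightarrow> g \<cdot> (js ! k) = h \<cdot> (js ! k)"
  shows "g = h"
proof -
  \<comment> \<open>The universal property is applied to the components of \<open>h\<close> itself:
    both \<open>g\<close> and \<open>h\<close> solve this problem, so they coincide.\<close>
  have "\<exists>!h'. h' \<in> Hom C P T \<and> (\<forall>k<length Xs. h' \<cdot> (js ! k) = map (\<lambda>j. h \<cdot> j) js ! k)"
    using compose_in_Hom[OF coproduct_in[OF c] h] HomD[OF h] coproduct_length[OF c]
    by (intro coproduct_ex1[OF c]) auto
  then show ?thesis using g h eq coproduct_length[OF c] by (metis nth_map)
qed

lemma coproductI: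
  assumes "set Xs \<subseteq> obj C" "P \<in> obj C" "length js = length Xs"
    and "\<And>k. k < length Xs \<Longrightarrow> js ! k \<in> Hom C (Xs ! k) P"
    and "\<And>T fs. \<lbrakk>T \<in> obj C; length fs = length Xs;
           \<And>k. k < length Xs \<Longrightarrow> fs ! k \<in> Hom C (Xs ! k) T\<rbrakk>
         \<Longrightarrow> \<exists>h. h \<in> Hom C P T \<and> (\<forall>k<length Xs. h \<cdot> (js ! k) = fs ! k)"
    and "\<And>T g h. \<lbrakk>g \<in> Hom C P T; h \<in> Hom C P T;
           \<And>k. k < length Xs \<Longrightarrow> g \<cdot> (js ! k) = h \<cdot> (js ! k)\<rbrakk> \<Longrightarrow> g = h"
  shows "is_coproduct C Xs P js"
  unfolding is_coproduct_def
proof (intro conjI ballI allI impI)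
  fix T fs
  assume "T \<in> obj C" and "length fs = length Xs \<and> (\<forall>k<length Xs. fs ! k \<in> Hom C (Xs ! k) T)"
  then show "\<exists>!h. h \<in> Hom C P T \<and> (\<forall>k<length Xs. h \<cdot> (js ! k) = fs ! k)"
    using assms(5)[of T fs] assms(6) by (metis (no_types, lifting))
qed (use assms in auto)

text \<open>An atomic decomposition presents an object only up to isomorphism. Moving the structure
  maps along the isomorphism makes the object itself the co-product.\<close>

lemma coproduct_transport:
  assumes c: "is_coproduct C Xs P js" and e: "e \<in> Hom C P Q" and e': "e' \<in> Hom C Q P"
    and inv: "e' \<cdot> e = ident C P" "e \<cdot> e' = ident C Q"
  shows "is_coproduct C Xs Q (map (\<lambda>j. e \<cdot> j) js)"
proof (rule coproductI)
  note len = coproduct_length[OF c]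
  note js = coproduct_in[OF c]
  show "set Xs \<subseteq> obj C" "Q \<in> obj C" "length (map (\<lambda>j. e \<cdot> j) js) = length Xs"
    using coproduct_obj[OF c] HomD[OF e] len by auto
  show "map (\<lambda>j. e \<cdot> j) js ! k \<in> Hom C (Xs ! k) Q" if "k < length Xs" for k
    using compose_in_Hom[OF js[OF that] e] that len by simp
  show "\<exists>h. h \<in> Hom C Q T \<and> (\<forall>k<length Xs. h \<cdot> (map (\<lambda>j. e \<cdot> j) js ! k) = fs ! k)"
    if T: "T \<in> obj C" and fs: "\<And>k. k < length Xs \<Longrightarrow> fs ! k \<in> Hom C (Xs ! k) T" for T fs
  proof -
    obtain h where h: "h \<in> Hom C P T" "\<And>k. k < length Xs \<Longrightarrow> h \<cdot> (js ! k) = fs ! k"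
      using coproduct_map[OF c T fs] by blast
    \<comment> \<open>The induced map out of \<open>Q\<close> is \<open>h \<cdot> e'\<close>, the
      map out of \<open>P\<close> preceded by the inverse isomorphism.\<close>
    have he: "(h \<cdot> e') \<cdot> e = h"
      using compose_assoc[OF e e' h(1)] compose_ident[OF h(1)] inv by simp
    have "(h \<cdot> e') \<cdot> (e \<cdot> (js ! k)) = fs ! k" if k: "k < length Xs" for k
      using compose_assoc[OF js[OF k] e compose_in_Hom[OF e' h(1)]] he h(2)[OF k] by simp
    then show ?thesis using compose_in_Hom[OF e' h(1)] len by (intro exI[of _ "h \<cdot> e'"]) simp
  qed
  show "g = h"
    if g: "g \<in> Hom C Q T" and h: "h \<in> Hom C Q T"
      and eq: "\<And>k. k < length Xs \<Longrightarrow> g \<cdot> (map (\<lambda>j. e \<cdot> j) js ! k) = h \<cdot> (map (\<lambda>j. e \<cdot> j) js ! k)"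
    for T g h
  proof -
    have "g \<cdot> e = h \<cdot> e"
    proof (rule coproduct_eq[OF c compose_in_Hom[OF e g] compose_in_Hom[OF e h]])
      fix k assume k: "k < length Xs"
      show "g \<cdot> e \<cdot> js ! k = h \<cdot> e \<cdot> js ! k"
        using eq[OF k] k len compose_assoc[OF js[OF k] e g] compose_assoc[OF js[OF k] e h] by simp
    qed
    then have "g \<cdot> (e \<cdot> e') = h \<cdot> (e \<cdot> e')"
      unfolding compose_assoc[OF e' e g, symmetric] compose_assoc[OF e' e h, symmetric] by (rule arg_cong)
    then show ?thesis unfolding inv compose_ident[OF g] compose_ident[OF h] .
  qed
qed

text \<open>Associativity of co-products. It reduces a list of summands to binary co-products, the
  form in which \<open>Hom_from_atom\<close> is stated.\<close>

lemma coproduct_Cons: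
  assumes c: "is_coproduct C (X # Xs) P (i # js)" and q: "is_coproduct C Xs Q ks"
  obtains h where "is_coproduct C [X, Q] P [i, h]" "\<And>k. k < length Xs \<Longrightarrow> h \<cdot> (ks ! k) = js ! k"
proof -
  have len: "length js = length Xs" using coproduct_length[OF c] by simp
  have P: "P \<in> obj C" and X: "X \<in> obj C" and Q: "Q \<in> obj C"
    using coproduct_obj[OF c] coproduct_obj[OF q] by auto
  have i: "i \<in> Hom C X P" using coproduct_in[OF c, of 0] by simp
  have js: "js ! k \<in> Hom C (Xs ! k) P" if "k < length Xs" for k
    using coproduct_in[OF c, of "Suc k"] that by simp
  note ks = coproduct_in[OF q]
  obtain h where h: "h \<in> Hom C Q P" and hk: "\<And>k. k < length Xs \<Longrightarrow> h \<cdot> (ks ! k) = js ! k"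
    using coproduct_map[OF q P js] by blast
  have "is_coproduct C [X, Q] P [i, h]"
  proof (rule coproductI)
    show "[i, h] ! k \<in> Hom C ([X, Q] ! k) P" if "k < length [X, Q]" for k
      using that i h by (auto simp: less_Suc_eq)
    show "\<exists>g. g \<in> Hom C P T \<and> (\<forall>k<length [X, Q]. g \<cdot> ([i, h] ! k) = fs ! k)"
      if T: "T \<in> obj C" and fs: "\<And>k. k < length [X, Q] \<Longrightarrow> fs ! k \<in> Hom C ([X, Q] ! k) T" for T fs
    proof -
      have f0: "fs ! 0 \<in> Hom C X T" and f1: "fs ! 1 \<in> Hom C Q T" using fs[of 0] fs[of 1] by auto
      \<comment> \<open>A pair of maps out of \<open>X\<close> and \<open>Q\<close> becomes a family
        on \<open>X # Xs\<close>: the second map is restricted along the structure maps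
        \<open>ks\<close> of \<open>Q\<close>.\<close>
      define F where "F k = (case k of 0 \<Rightarrow> fs ! 0 | Suc k \<Rightarrow> fs ! 1 \<cdot> ks ! k)" for k
      have "F k \<in> Hom C ((X # Xs) ! k) T" if "k < length (X # Xs)" for k
        using that f0 compose_in_Hom[OF ks f1] by (cases k) (auto simp: F_def)
      then obtain g where g: "g \<in> Hom C P T"
        and gk: "\<And>k. k < length (X # Xs) \<Longrightarrow> g \<cdot> ((i # js) ! k) = F k"
        using coproduct_map[OF c T] by blast
      have "g \<cdot> h = fs ! 1"
      proof (rule coproduct_eq[OF q compose_in_Hom[OF h g] f1])
        fix k assume k: "k < length Xs"
        show "g \<cdot> h \<cdot> ks ! k = fs ! 1 \<cdot> ks ! k"
          using compose_assoc[OF ks[OF k] h g] hk[OF k] gk[of "Suc k"] k by (simp add: F_def)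
      qed
      moreover have "g \<cdot> i = fs ! 0" using gk[of 0] by (simp add: F_def)
      ultimately show ?thesis using g by (auto simp: less_Suc_eq)
    qed
    show "a = b"
      if a: "a \<in> Hom C P T" and b: "b \<in> Hom C P T"
        and eq: "\<And>k. k < length [X, Q] \<Longrightarrow> a \<cdot> ([i, h] ! k) = b \<cdot> ([i, h] ! k)" for T a b
    proof (rule coproduct_eq[OF c a b])
      have e: "a \<cdot> i = b \<cdot> i" "a \<cdot> h = b \<cdot> h" using eq[of 0] eq[of 1] by auto
      fix k assume k: "k < length (X # Xs)"
      show "a \<cdot> (i # js) ! k = b \<cdot> (i # js) ! k"
      proof (cases k)
        case (Suc l)
        then have l: "l < length Xs" using k by simp
        show ?thesis
          using compose_assoc[OF ks[OF l] h a] compose_assoc[OF ks[OF l] h b] hk[OF l] e Suc by simp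
      qed (use e in simp)
    qed
  qed (use P X Q in auto)
  then show ?thesis using hk that by blast
qed

end

section \<open>Atoms and the maps out of them\<close>

context B_category
begin

lemma binary_coproduct:
  assumes "Y \<in> obj C" "Z \<in> obj C"
  obtains P i j where "is_coproduct C [Y, Z] P [i, j]" "i \<in> Hom C Y P" "j \<in> Hom C Z P"
proof -
  obtain P js where c: "is_coproduct C [Y, Z] P js"
    using finite_coproducts assms by (force simp: has_finite_coproducts_def)
  then obtain i j where "js = [i, j]"
    using coproduct_length[OF c] by (auto simp: length_Suc_conv numeral_2_eq_2)
  then show ?thesis using that c coproduct_in[OF c, of 0] coproduct_in[OF c, of 1] by auto
qed

lemma atom_coproduct:
  assumes X: "X \<in> obj C"
  obtains As js where "\<And>A. A \<in> set As \<Longrightarrow> is_atom C A" "is_coproduct C As X js"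
proof -
  obtain As P js where A: "\<forall>A\<in>set As. is_atom C A" and c: "is_coproduct C As P js"
    and i: "isomorphic C X P" using atomic_decomposition[OF X] by blast
  obtain e' where e': "e' \<in> Hom C X P" "is_iso C e'" using i by (auto simp: isomorphic_def)
  obtain e where "e \<in> Hom C P X" "e \<cdot> e' = ident C X" "e' \<cdot> e = ident C P"
    using is_isoE[OF e'(2,1)] .
  from coproduct_transport[OF c this(1) e'(1) this(3,2)] show ?thesis using A by (intro that) auto
qed

text \<open>The injectivity half of \<open>Hom_from_atom\<close>, read within the first summand,
  within the second, and across the two, where it expresses disjointness.\<close>

lemma inclusion_inj:
  assumes "is_atom C A" "is_coproduct C [Y, Z] P [i, j]"
  shows "\<lbrakk>g \<in> Hom C A Y; h \<in> Hom C A Y; i \<cdot> g = i \<cdot> h\<rbrakk> \<Longrightarrow> g = h"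
    and "\<lbrakk>g \<in> Hom C A Z; h \<in> Hom C A Z; j \<cdot> g = j \<cdot> h\<rbrakk> \<Longrightarrow> g = h"
    and "\<lbrakk>g \<in> Hom C A Y; h \<in> Hom C A Z\<rbrakk> \<Longrightarrow> i \<cdot> g \<noteq> j \<cdot> h"
proof -
  have inj: "inj_on (case_sum (\<lambda>f. i \<cdot> f) (\<lambda>g. j \<cdot> g)) (Hom C A Y <+> Hom C A Z)"
    using Hom_from_atom[OF assms] by (rule bij_betw_imp_inj_on)
  show "g = h" if "g \<in> Hom C A Y" "h \<in> Hom C A Y" "i \<cdot> g = i \<cdot> h"
    using inj_onD[OF inj, of "Inl g" "Inl h"] that by (simp add: InlI)
  show "g = h" if "g \<in> Hom C A Z" "h \<in> Hom C A Z" "j \<cdot> g = j \<cdot> h"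
    using inj_onD[OF inj, of "Inr g" "Inr h"] that by (simp add: InrI)
  show "i \<cdot> g \<noteq> j \<cdot> h" if "g \<in> Hom C A Y" "h \<in> Hom C A Z"
    using inj_onD[OF inj, of "Inl g" "Inr h"] that by (auto simp: InlI InrI)
qed

text \<open>The surjectivity half of \<open>Hom_from_atom\<close>.\<close>

lemma atom_map_binary:
  assumes "is_atom C A" "is_coproduct C [Y, Z] P [i, j]" "f \<in> Hom C A P"
  shows "(\<exists>g\<in>Hom C A Y. f = i \<cdot> g) \<or> (\<exists>g\<in>Hom C A Z. f = j \<cdot> g)"
  using bij_betw_imp_surj_on[OF Hom_from_atom[OF assms(1,2)]] assms(3) by (force simp: Plus_def)

text \<open>As \<open>P\<close> is initial, the two inclusions of \<open>P\<close> into
  \<open>P \<amalg> P\<close> coincide; composed with a map from an atom they would have to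
  differ.\<close>

lemma no_atom_map_to_initial:
  assumes A: "is_atom C A" and c: "is_coproduct C [] P []" and f: "f \<in> Hom C A P"
  shows False
proof -
  have P: "P \<in> obj C" using coproduct_obj[OF c] by simp
  have id: "ident C P \<in> Hom C P P" using ident_in_Hom[OF P] .
  obtain Q i j where q: "is_coproduct C [P, P] Q [i, j]" "i \<in> Hom C P Q" "j \<in> Hom C P Q"
    using binary_coproduct[OF P P] .
  have "i = j" using coproduct_eq[OF c q(2,3)] by simp
  then show False using inclusion_inj(3)[OF A q(1) f f] by simp
qed

text \<open>Induction on the list of summands: the empty co-product receives no map from an atom,
  and otherwise the binary case decides between the head and the co-product of the tail.\<close>

lemma atom_map_coproduct:
  assumes "is_atom C A" "is_coproduct C Xs P js" "f \<in> Hom C A P"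
  shows "\<exists>k<length Xs. \<exists>g\<in>Hom C A (Xs ! k). f = js ! k \<cdot> g"
  using assms(2,3)
proof (induction Xs arbitrary: P js f)
  case Nil
  then show ?case using no_atom_map_to_initial[OF assms(1)] coproduct_length by fastforce
next
  case (Cons X Xs)
  obtain i is' where js: "js = i # is'" using coproduct_length[OF Cons.prems(1)] by (cases js) auto
  obtain Q ks where q: "is_coproduct C Xs Q ks"
    using finite_coproducts coproduct_obj[OF Cons.prems(1)] by (force simp: has_finite_coproducts_def)
  obtain h where h: "is_coproduct C [X, Q] P [i, h]"
    and hk: "\<And>k. k < length Xs \<Longrightarrow> h \<cdot> (ks ! k) = is' ! k"
    using coproduct_Cons Cons.prems(1) q js by blast
  have hQ: "h \<in> Hom C Q P" using coproduct_in[OF h, of 1] by simp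
  from atom_map_binary[OF assms(1) h Cons.prems(2)] show ?case
  proof
    assume "\<exists>g\<in>Hom C A X. f = i \<cdot> g"
    then show ?thesis using js by (intro exI[of _ 0]) auto
  next
    assume "\<exists>g\<in>Hom C A Q. f = h \<cdot> g"
    then obtain g where g: "g \<in> Hom C A Q" "f = h \<cdot> g" by blast
    then obtain k g' where k: "k < length Xs" "g' \<in> Hom C A (Xs ! k)" "g = ks ! k \<cdot> g'"
      using Cons.IH[OF q g(1)] by blast
    have "f = is' ! k \<cdot> g'" using compose_assoc[OF k(2) coproduct_in[OF q k(1)] hQ] g k hk by simp
    then show ?thesis using k js by (intro exI[of _ "Suc k"]) auto
  qed
qed

text \<open>Every test object \<open>T\<close> is a co-product of atoms, so two maps out of
  \<open>T\<close> are equal once they agree on these atoms.\<close>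

lemma mono_if_inj_on_atoms:
  assumes f: "f \<in> Hom C X Y"
    and inj: "\<And>A g h. \<lbrakk>is_atom C A; g \<in> Hom C A X; h \<in> Hom C A X; f \<cdot> g = f \<cdot> h\<rbrakk> \<Longrightarrow> g = h"
  shows "is_mono C f"
proof (rule is_monoI[OF f])
  fix T g h assume T: "T \<in> obj C" and g: "g \<in> Hom C T X" and h: "h \<in> Hom C T X"
    and eq: "f \<cdot> g = f \<cdot> h"
  obtain As js where A: "\<And>A. A \<in> set As \<Longrightarrow> is_atom C A" and c: "is_coproduct C As T js"
    using atom_coproduct[OF T] by metis
  show "g = h"
  proof (rule coproduct_eq[OF c g h])
    fix k assume k: "k < length As"
    note a = coproduct_in[OF c k]
    have "f \<cdot> (g \<cdot> js ! k) = f \<cdot> (h \<cdot> js ! k)"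
      using compose_assoc[OF a g f] compose_assoc[OF a h f] eq by simp
    then show "g \<cdot> js ! k = h \<cdot> js ! k"
      by (rule inj[OF A[OF nth_mem[OF k]] compose_in_Hom[OF a g] compose_in_Hom[OF a h]])
  qed
qed

text \<open>A binary inclusion \<open>j\<close> is mono because it is injective on maps from atoms.
  The general inclusion is a right factor of such a \<open>j\<close>, hence mono too.\<close>

lemma coproduct_inclusion_mono:
  assumes c: "is_coproduct C Xs P js" and k: "k < length Xs"
  shows "is_mono C (js ! k)"
proof -
  have P: "P \<in> obj C" and X: "Xs ! k \<in> obj C" using coproduct_obj[OF c] k by auto
  obtain Q i j where q: "is_coproduct C [P, Xs ! k] Q [i, j]" "i \<in> Hom C P Q" "j \<in> Hom C (Xs ! k) Q"
    using binary_coproduct[OF P X] .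
  \<comment> \<open>The factorization \<open>j = h \<cdot> js ! k\<close> comes from sending summand
    \<open>k\<close> to its extra copy in \<open>Q\<close>; on the other summands any map to
    \<open>Q\<close> would do, and the one through \<open>P\<close> is at hand.\<close>
  have "(if l = k then j else i \<cdot> js ! l) \<in> Hom C (Xs ! l) Q" if "l < length Xs" for l
    using q(3) compose_in_Hom[OF coproduct_in[OF c that] q(2)] by auto
  then obtain h where h: "h \<in> Hom C P Q"
    and hl: "\<And>l. l < length Xs \<Longrightarrow> h \<cdot> js ! l = (if l = k then j else i \<cdot> js ! l)"
    using coproduct_map[OF c, of Q "\<lambda>l. if l = k then j else i \<cdot> js ! l"] HomD[OF q(2)] by blast
  have "is_mono C j" using mono_if_inj_on_atoms[OF q(3)] inclusion_inj(2)[OF _ q(1)] by blast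
  then show ?thesis using mono_cancel[OF coproduct_in[OF c k] h] hl[OF k] by simp
qed

section \<open>Lifting the atomic summands of the target, and assembling the section\<close>

lemma atom_inclusion_lift:
  assumes f: "f \<in> Hom C X Y" "is_mono C f" "is_epi C f"
    and B: "\<And>B. B \<in> set Bs \<Longrightarrow> is_atom C B" and c: "is_coproduct C Bs Y bs" and k: "k < length Bs"
  shows "\<exists>g\<in>Hom C (Bs ! k) X. f \<cdot> g = bs ! k"
proof (rule ccontr)
  assume no_lift: "\<not> (\<exists>g\<in>Hom C (Bs ! k) X. f \<cdot> g = bs ! k)"
  have X: "X \<in> obj C" and Y: "Y \<in> obj C" using HomD[OF f(1)] by auto
  note b = coproduct_in[OF c]
  obtain As as' where A: "\<And>A. A \<in> set As \<Longrightarrow> is_atom C A" and d: "is_coproduct C As X as'"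
    using atom_coproduct[OF X] by metis
  obtain Q u w where q: "is_coproduct C [Y, Y] Q [u, w]" "u \<in> Hom C Y Q" "w \<in> Hom C Y Q"
    using binary_coproduct[OF Y Y] .
  have "(if l = k then w else u) \<cdot> bs ! l \<in> Hom C (Bs ! l) Q" if "l < length Bs" for l
    using compose_in_Hom[OF b[OF that]] q by auto
  then obtain v where v: "v \<in> Hom C Y Q"
    and vl: "\<And>l. l < length Bs \<Longrightarrow> v \<cdot> bs ! l = (if l = k then w else u) \<cdot> bs ! l"
    using coproduct_map[OF c, of Q "\<lambda>l. (if l = k then w else u) \<cdot> bs ! l"] HomD[OF q(2)] by blast
  have "u \<cdot> f = v \<cdot> f"
  proof (rule coproduct_eq[OF d compose_in_Hom[OF f(1) q(2)] compose_in_Hom[OF f(1) v]])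
    fix m assume m: "m < length As"
    let ?a = "as' ! m"
    note a = coproduct_in[OF d m]
    have atom: "is_atom C (As ! m)" using A m by simp
    obtain l g where l: "l < length Bs" and g: "g \<in> Hom C (As ! m) (Bs ! l)" and eq: "f \<cdot> ?a = bs ! l \<cdot> g"
      using atom_map_coproduct[OF atom c compose_in_Hom[OF a f(1)]] by blast
    have "l \<noteq> k"
    proof
      assume lk: "l = k"
      \<comment> \<open>The composite of the inclusion of an atom with \<open>f\<close> is mono and
        factors as \<open>bs ! l \<cdot> g\<close>, so its right factor \<open>g\<close> is a mono
        of atoms.\<close>
      have "is_mono C (f \<cdot> ?a)" using mono_compose[OF a coproduct_inclusion_mono[OF d m] f(1,2)] .
      then have "is_mono C g" using mono_cancel[OF g b[OF l]] eq by simp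
      then have "is_iso C g" using mono_of_atoms_iso[OF atom B g] l by simp
      then obtain g' where g': "g' \<in> Hom C (Bs ! l) (As ! m)" "g \<cdot> g' = ident C (Bs ! l)"
        using is_isoE[OF _ g] by blast
      \<comment> \<open>Inverting \<open>g\<close> in \<open>f \<cdot> ?a = bs ! l \<cdot> g\<close>
        exhibits \<open>?a \<cdot> g'\<close> as the forbidden lift.\<close>
      have "f \<cdot> (?a \<cdot> g') = bs ! l"
        using compose_assoc[OF g'(1) a f(1)] compose_assoc[OF g'(1) g b[OF l]] eq g'(2)
          compose_ident[OF b[OF l]] by simp
      then show False using no_lift compose_in_Hom[OF g'(1) a] lk by blast
    qed
    then have "u \<cdot> (bs ! l \<cdot> g) = v \<cdot> (bs ! l \<cdot> g)"
      using compose_assoc[OF g b[OF l] q(2)] compose_assoc[OF g b[OF l] v] vl[OF l] by simp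
    then show "u \<cdot> f \<cdot> ?a = v \<cdot> f \<cdot> ?a"
      using compose_assoc[OF a f(1) q(2)] compose_assoc[OF a f(1) v] eq by simp
  qed
  then have "u = v" using is_epiD[OF f(3,1) q(2) v] by blast
  \<comment> \<open>On summand \<open>k\<close> the map \<open>v\<close> is \<open>w\<close>, so
    \<open>u = v\<close> identifies the two inclusions on the atom \<open>Bs ! k\<close>.\<close>
  then have "u \<cdot> bs ! k = w \<cdot> bs ! k" using vl[OF k] by simp
  then show False using inclusion_inj(3)[OF B q(1) b[OF k] b[OF k]] k by simp
qed

lemma mono_epi_iso:
  assumes f: "f \<in> Hom C X Y" "is_mono C f" "is_epi C f"
  shows "is_iso C f"
proof -
  have X: "X \<in> obj C" and Y: "Y \<in> obj C" using HomD[OF f(1)] by auto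
  obtain Bs bs where B: "\<And>B. B \<in> set Bs \<Longrightarrow> is_atom C B" and c: "is_coproduct C Bs Y bs"
    using atom_coproduct[OF Y] by metis
  note b = coproduct_in[OF c]
  \<comment> \<open>A lift is chosen for each atomic summand; \<open>G\<close> is the family from
    which the section \<open>s\<close> is induced.\<close>
  obtain G where G: "\<And>k. k < length Bs \<Longrightarrow> G k \<in> Hom C (Bs ! k) X \<and> f \<cdot> G k = bs ! k"
    using atom_inclusion_lift[OF f B c] by metis
  obtain s where s: "s \<in> Hom C Y X" and sk: "\<And>k. k < length Bs \<Longrightarrow> s \<cdot> bs ! k = G k"
    using coproduct_map[OF c X] G by metis
  have "f \<cdot> s = ident C Y"
  proof (rule coproduct_eq[OF c compose_in_Hom[OF s f(1)] ident_in_Hom[OF Y]])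
    fix k assume k: "k < length Bs"
    show "f \<cdot> s \<cdot> bs ! k = ident C Y \<cdot> bs ! k"
      using compose_assoc[OF b[OF k] s f(1)] sk[OF k] G[OF k] ident_compose[OF b[OF k]] by simp
  qed
  then show ?thesis using mono_with_section_iso[OF f(1,2) s] by blast
qed

end

theorem corollary3p13:
  fixes C :: "('o, 'm) cat_data"
  assumes "B_category C"
  shows "balanced C"
  using B_category.mono_epi_iso[OF assms] by (auto simp: balanced_def Hom_def)

end
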